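(* Let $F:(\mathbb{F}^d)^{\mathbb{N}}_c\to\mathbb{F}$ be polynomial, invariant to time warping and invariant to space translations. Then $F$ is realised as a quasisymmetric function (of level $d$), i.e. there exists a quasisymmetric function $Q$ of level $d$ over $\mathbb{F}$ such that for every $x\in(\mathbb{F}^d)^{\mathbb{N}}_c$, $F(x)$ equals the evaluation of $Q$ at $Y_j^{[a]}=x_j^{[a]}-x_{j-1}^{[a]}$, $j\ge1$, $a\in\{1,\dots,d\}$.
   Context: $\mathbb{F}$ is a field of characteristic zero, $d\ge1$, $\mathbb{N}=\{0,1,2,\dots\}$. $(\mathbb{F}^d)^{\mathbb{N}}_c$ denotes the set of sequences $x=(x_0,x_1,x_2,\dots)$ in $\mathbb{F}^d$ that are eventually constant; $x_j=(x_j^{[1]},\dots,x_j^{[d]})$. Time warping. For $n\ge0$, the operator $\tau_n$ on sequences repeats the value at time $n$ once: $\tau_n(x)_j=x_j$ if $j\le n$ and $\tau_n(x)_j=x_{j-1}$ if $j>n$. $F$ is invariant to time warping if $F\circ\tau_n=F$ for all $n\ge0$. Space translations. $F$ is invariant to space translations if $F((x_j+c)_{j\ge0})=F(x)$ for all $x$ and all $c\in\mathbb{F}^d$. Polynomial. $F$ is polynomial if for all $N\ge1$, $F(x_0,\dots,x_N,0,0,\dots)$ is a polynomial in (the coordinates of) $x_0,\dots,x_N$, and the degree of these polynomials is bounded uniformly in $N$. Quasisymmetric functions of level $d$. Let $A=\{1,\dots,d\}$ and let $\mathfrak{A}$ be the free commutative semigroup (without unit) on $A$, with elements written $[a_1\cdots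 a_p]$, $p\ge1$, $a_i\in A$ (nonempty commutative monomials). Let $Y_j^{[a]}$, $j\ge1$, $a\in A$, be commuting variables and set $Y_j^{[a_1\cdots a_p]}=Y_j^{[a_1]}\cdots Y_j^{[a_p]}$. The quasisymmetric functions of level $d$ are the finite $\mathbb{F}$-linear combinations of the formal power series $$M_{[u_1]\cdots[u_k]}=\sum_{1\le j_1<\cdots<j_k}Y_{j_1}^{[u_1]}\cdots Y_{j_k}^{[u_k]},\qquad k\ge0,\ u_1,\dots,u_k\in\mathfrak{A},$$ with the value $1$ for $k=0$. (For $d=1$ these are the usual quasisymmetric functions.) Evaluation at the increments of an eventually constant sequence makes sense since only finitely many increments are nonzero. *)

theory Defs
  imports
    "HOL-Analysis.Finite_Cartesian_Product"
    "HOL-Library.Multiset"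
    "HOL-Library.Poly_Mapping"
begin

section \<open>Eventually constant sequences and operations on them\<close>

definition ev_const :: "(nat \<Rightarrow> 'a) set" where
  "ev_const = {x. \<exists>c. \<forall>\<^sub>F j in sequentially. x j = c}"

definition time_warp :: "nat \<Rightarrow> (nat \<Rightarrow> 'a) \<Rightarrow> nat \<Rightarrow> 'a" where
  "time_warp n x = (\<lambda>j. if j \<le> n then x j else x (j - 1))"

text \<open>A function on eventually constant sequences is a total function
  whose values outside \<open>ev_const\<close> are never constrained.\<close>

definition warp_invariant :: "((nat \<Rightarrow> 'a) \<Rightarrow> 'b) \<Rightarrow> bool" where
  "warp_invariant F \<longleftrightarrow> (\<forall>n. \<forall>x\<in>ev_const. F (time_warp n x) = F x)"

definition translation_invariant :: "((nat \<Rightarrow> 'a::plus) \<Rightarrow> 'b) \<Rightarrow> bool" where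
  "translation_invariant F \<longleftrightarrow> (\<forall>c. \<forall>x\<in>ev_const. F (\<lambda>j. x j + c) = F x)"

section \<open>Polynomials and formal power series in many variables\<close>

text \<open>A monomial in variables from \<open>'v\<close> is the multiset of its factors, so the product of
  monomials is the sum of multisets and the total degree of a monomial is its size.\<close>

type_synonym 'v monomial = "'v multiset"
type_synonym ('v, 'f) mpoly = "'v monomial \<Rightarrow>\<^sub>0 'f"
type_synonym ('v, 'f) mseries = "'v monomial \<Rightarrow> 'f"

definition eval_mon :: "('v \<Rightarrow> 'f::comm_monoid_mult) \<Rightarrow> 'v monomial \<Rightarrow> 'f" where
  "eval_mon y m = (\<Prod>v\<in>#m. y v)"

definition eval_mpoly :: "('v \<Rightarrow> 'f::comm_semiring_1) \<Rightarrow> ('v, 'f) mpoly \<Rightarrow> 'f" where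
  "eval_mpoly y p = (\<Sum>m\<in>Poly_Mapping.keys p. Poly_Mapping.lookup p m * eval_mon y m)"

definition mpoly_vars :: "('v, 'f::zero) mpoly \<Rightarrow> 'v set" where
  "mpoly_vars p = (\<Union>m\<in>Poly_Mapping.keys p. set_mset m)"

definition mpoly_degree :: "('v, 'f::zero) mpoly \<Rightarrow> nat" where
  "mpoly_degree p = Max (insert 0 (size ` Poly_Mapping.keys p))"

text \<open>Monomials containing a variable on which \<open>y\<close> vanishes contribute nothing and are omitted.
  The sum is finite when \<open>y\<close> has finite support and the series has bounded degree, as is the case
  for quasisymmetric functions (lemma \<open>finite_eval_mseries\<close> below).\<close>

definition eval_mseries :: "('v \<Rightarrow> 'f::comm_semiring_1) \<Rightarrow> ('v, 'f) mseries \<Rightarrow> 'f" where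
  "eval_mseries y Q =
    (\<Sum>m | Q m \<noteq> 0 \<and> set_mset m \<subseteq> {v. y v \<noteq> 0}. Q m * eval_mon y m)"

section \<open>Polynomial functions of sequences\<close>

text \<open>The variable \<open>(j, a)\<close> stands for the coordinate \<open>a\<close> of the entry \<open>x j\<close>.\<close>

definition polynomial_seq_fun :: "((nat \<Rightarrow> 'f::comm_semiring_1 ^ 'd) \<Rightarrow> 'f) \<Rightarrow> bool" where
  "polynomial_seq_fun F \<longleftrightarrow>
    (\<exists>D. \<forall>N\<ge>1. \<exists>p :: (nat \<times> 'd, 'f) mpoly.
      mpoly_vars p \<subseteq> {..N} \<times> UNIV \<and> mpoly_degree p \<le> D \<and>
      (\<forall>x. F (\<lambda>j. if j \<le> N then x j else 0) = eval_mpoly (\<lambda>(j, a). x j $ a) p))"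

section \<open>Quasisymmetric functions of level \<open>d\<close>\<close>

text \<open>The variable \<open>(j, a)\<close> stands for \<open>Y\<^sub>j\<^bsup>[a]\<^esup>\<close>; elements of the free commutative semigroup without
  unit on the letters \<open>'d\<close> are the nonempty multisets.\<close>

definition Y_mon :: "nat \<Rightarrow> 'd multiset \<Rightarrow> (nat \<times> 'd) monomial" where
  "Y_mon j u = image_mset (Pair j) u"

definition word_mon :: "'d multiset list \<Rightarrow> nat list \<Rightarrow> (nat \<times> 'd) monomial" where
  "word_mon us js = sum_list (map2 Y_mon js us)"

definition index_tuples :: "nat \<Rightarrow> nat list set" where
  "index_tuples k = {js. length js = k \<and> sorted_wrt (<) js \<and> (\<forall>j\<in>set js. 1 \<le> j)}"

text \<open>The coefficient of \<open>m\<close> in \<open>\<Sum>\<^bsub>js\<^esub> word_mon us js\<close> is the number of index tuples \<open>js\<close>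
  yielding \<open>m\<close>.\<close>

definition monomial_qsym :: "'d multiset list \<Rightarrow> (nat \<times> 'd, 'f::semiring_1) mseries" where
  "monomial_qsym us =
    (\<lambda>m. of_nat (card {js \<in> index_tuples (length us). word_mon us js = m}))"

definition qsym :: "(nat \<times> 'd, 'f::semiring_1) mseries set" where
  "qsym = {Q. \<exists>W c. finite W \<and> (\<forall>us\<in>W. \<forall>u\<in>set us. u \<noteq> {#}) \<and>
    Q = (\<lambda>m. \<Sum>us\<in>W. c us * monomial_qsym us m)}"

text \<open>Only \<open>j \<ge> 1\<close> is relevant; at \<open>j = 0\<close> the value is \<open>0\<close>.\<close>

definition increments :: "(nat \<Rightarrow> 'f::group_add ^ 'd) \<Rightarrow> nat \<times> 'd \<Rightarrow> 'f" where
  "increments x = (\<lambda>(j, a). x j $ a - x (j - 1) $ a)"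

section \<open>Finiteness of the sums involved\<close>

lemma size_word_mon:
  "length js = length us \<Longrightarrow> size (word_mon us js) = sum_list (map size us)"
  unfolding word_mon_def
  by (induction js us rule: list_induct2) (auto simp: Y_mon_def)

lemma word_mon_indices:
  "length js = length us \<Longrightarrow> \<forall>u\<in>set us. u \<noteq> {#} \<Longrightarrow>
    fst ` set_mset (word_mon us js) = set js"
  unfolding word_mon_def
  by (induction js us rule: list_induct2) (auto simp: Y_mon_def image_Un image_image)

lemma finite_index_tuples_of_monomial:
  assumes "\<forall>u\<in>set us. u \<noteq> {#}"
  shows "finite {js \<in> index_tuples (length us). word_mon us js = m}"
proof (rule finite_subset)
  show "{js \<in> index_tuples (length us). word_mon us js = m} \<subseteq>
    {js. set js \<subseteq> fst ` set_mset m \<and> length js = length us}"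
    using word_mon_indices[OF _ assms] by (auto simp: index_tuples_def)
  show "finite {js. set js \<subseteq> fst ` set_mset m \<and> length js = length us}"
    by (rule finite_lists_length_eq) simp
qed

lemma finite_eval_mseries:
  fixes Q :: "(nat \<times> 'd, 'f::semiring_1) mseries"
  assumes "Q \<in> qsym" and "finite S"
  shows "finite {m. Q m \<noteq> 0 \<and> set_mset m \<subseteq> S}"
proof -
  from assms(1) obtain W c where W: "finite W"
    and Q: "Q = (\<lambda>m. \<Sum>us\<in>W. c us * monomial_qsym us m)"
    unfolding qsym_def by blast
  have fin: "finite {m. size m = n \<and> set_mset m \<subseteq> S}" for n
  proof (rule finite_subset)
    show "{m. size m = n \<and> set_mset m \<subseteq> S} \<subseteq> mset ` {xs. set xs \<subseteq> S \<and> length xs = n}"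
    proof
      fix m assume m: "m \<in> {m. size m = n \<and> set_mset m \<subseteq> S}"
      obtain xs where "mset xs = m" using ex_mset by blast
      with m show "m \<in> mset ` {xs. set xs \<subseteq> S \<and> length xs = n}" by auto
    qed
    show "finite (mset ` {xs. set xs \<subseteq> S \<and> length xs = n})"
      by (intro finite_imageI finite_lists_length_eq assms(2))
  qed
  have "{m. Q m \<noteq> 0 \<and> set_mset m \<subseteq> S} \<subseteq>
    (\<Union>us\<in>W. {m. size m = sum_list (map size us) \<and> set_mset m \<subseteq> S})"
  proof
    fix m assume m: "m \<in> {m. Q m \<noteq> 0 \<and> set_mset m \<subseteq> S}"
    then obtain us where us: "us \<in> W" "c us * monomial_qsym us m \<noteq> 0"
      unfolding Q using sum.not_neutral_contains_not_neutral by blast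
    then have "{js \<in> index_tuples (length us). word_mon us js = m} \<noteq> {}"
      by (auto simp: monomial_qsym_def simp del: Collect_empty_eq)
    then obtain js where "js \<in> index_tuples (length us)" "word_mon us js = m" by blast
    then have "size m = sum_list (map size us)"
      using size_word_mon[of js us] by (auto simp: index_tuples_def)
    with us m show "m \<in> (\<Union>us\<in>W. {m. size m = sum_list (map size us) \<and> set_mset m \<subseteq> S})"
      by blast
  qed
  then show ?thesis
    using W fin by (meson finite_UN_I finite_subset)
qed

lemma finite_increments:
  fixes x :: "nat \<Rightarrow> 'f::group_add ^ 'd"
  assumes "x \<in> ev_const"
  shows "finite {v. increments x v \<noteq> 0}"
proof -
  from assms obtain c n where x: "\<And>j. j \<ge> n \<Longrightarrow> x j = c"
    unfolding ev_const_def eventually_sequentially by blast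
  have "{v. increments x v \<noteq> 0} \<subseteq> {..n} \<times> (UNIV :: 'd set)"
  proof
    fix v assume "v \<in> {v. increments x v \<noteq> 0}"
    moreover obtain j a where v: "v = (j, a)" by (cases v)
    ultimately have "x j $ a \<noteq> x (j - 1) $ a" by (simp add: increments_def)
    then have "\<not> n \<le> j - 1" using x[of j] x[of "j - 1"] by auto
    then show "v \<in> {..n} \<times> UNIV" using v by auto
  qed
  then show ?thesis by (rule finite_subset) simp
qed

end

theory Submission imports Defs begin

text \<open>By translation invariance the last value may be subtracted, so on sequences that are constant
  from time \<open>N\<close> on, \<open>F\<close> is a polynomial \<open>P\<^sub>N\<close> in the increments \<open>y\<^sub>1, \<dots>, y\<^sub>N\<close>; time warping inserts
  zero increments. Split \<open>P\<^sub>N\<close> into the parts consisting of the monomials whose set of indices is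
  exactly \<open>T\<close>. Restricting \<open>y\<close> to a set of indices selects the parts below it, so the parts are
  determined by the values of \<open>F\<close> on restrictions by Moebius inversion, and warp invariance
  identifies the part at \<open>T\<close> with the full part of \<open>P\<^sub>k\<close>, \<open>k = card T\<close>, evaluated at the increments
  indexed by \<open>T\<close>. Hence the coefficients of the full parts are the coefficients of the
  quasisymmetric function. Inverting on values rather than comparing coefficients makes uniqueness
  of coefficients unnecessary.\<close>

section \<open>Polynomials of bounded degree as functions\<close>

definition mons :: "'v set \<Rightarrow> nat \<Rightarrow> 'v monomial set" where
  "mons V D = {m. set_mset m \<subseteq> V \<and> size m \<le> D}"

text \<open>Polynomials are handled as functions with some coefficient family on
  \<open>mons V D\<close>, so that substitution of linear forms needs only closure under sums,
  scalars and multiplication by a variable.\<close>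

definition poly_funs :: "'v set \<Rightarrow> nat \<Rightarrow> (('v \<Rightarrow> 'f::comm_semiring_1) \<Rightarrow> 'f) set" where
  "poly_funs V D = {g. \<exists>c. \<forall>y. g y = (\<Sum>m\<in>mons V D. c m * eval_mon y m)}"

lemma finite_mons:
  assumes "finite V"
  shows "finite (mons V D)"
proof (rule finite_subset)
  show "mons V D \<subseteq> mset ` {xs. set xs \<subseteq> V \<and> length xs \<le> D}"
  proof
    fix m assume m: "m \<in> mons V D"
    obtain xs where "mset xs = m" using ex_mset by blast
    with m show "m \<in> mset ` {xs. set xs \<subseteq> V \<and> length xs \<le> D}" by (auto simp: mons_def)
  qed
  show "finite (mset ` {xs. set xs \<subseteq> V \<and> length xs \<le> D})"
    by (intro finite_imageI finite_lists_length_le assms)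
qed

lemma mem_mons_Times_UNIV:
  "m \<in> mons (I \<times> UNIV) D \<longleftrightarrow> fst ` set_mset m \<subseteq> I \<and> size m \<le> D"
  by (auto simp: mons_def mem_Times_iff)

lemma poly_funs_zero: "(\<lambda>y. 0) \<in> poly_funs V D"
  unfolding poly_funs_def by (auto intro!: exI[of _ "\<lambda>_. 0"])

lemma poly_funs_add:
  assumes "g \<in> poly_funs V D" "h \<in> poly_funs V D"
  shows "(\<lambda>y. g y + h y) \<in> poly_funs V D"
proof -
  from assms obtain c d where
    "\<forall>y. g y = (\<Sum>m\<in>mons V D. c m * eval_mon y m)"
    "\<forall>y. h y = (\<Sum>m\<in>mons V D. d m * eval_mon y m)"
    unfolding poly_funs_def by blast
  then show ?thesis
    unfolding poly_funs_def
    by (auto intro!: exI[of _ "\<lambda>m. c m + d m"] simp: sum.distrib distrib_right)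
qed

lemma poly_funs_cmult:
  assumes "g \<in> poly_funs V D"
  shows "(\<lambda>y. a * g y) \<in> poly_funs V D"
proof -
  from assms obtain c where "\<forall>y. g y = (\<Sum>m\<in>mons V D. c m * eval_mon y m)"
    unfolding poly_funs_def by blast
  then show ?thesis
    unfolding poly_funs_def
    by (auto intro!: exI[of _ "\<lambda>m. a * c m"] simp: sum_distrib_left mult.assoc)
qed

lemma poly_funs_sum:
  "(\<And>i. i \<in> I \<Longrightarrow> g i \<in> poly_funs V D) \<Longrightarrow> (\<lambda>y. \<Sum>i\<in>I. g i y) \<in> poly_funs V D"
proof (induction I rule: infinite_finite_induct)
  case (insert i I)
  then have "(\<lambda>y. g i y + (\<Sum>i\<in>I. g i y)) \<in> poly_funs V D"
    by (intro poly_funs_add) auto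
  then show ?case using insert by simp
qed (simp_all add: poly_funs_zero)

lemma poly_funs_mono:
  assumes "g \<in> poly_funs V D" "D \<le> E" "finite V"
  shows "g \<in> poly_funs V E"
proof -
  from assms obtain c where c: "\<And>y. g y = (\<Sum>m\<in>mons V D. c m * eval_mon y m)"
    unfolding poly_funs_def by blast
  have "g y = (\<Sum>m\<in>mons V E. (if m \<in> mons V D then c m else 0) * eval_mon y m)" for y
    unfolding c using assms finite_mons[OF assms(3), of E]
    by (intro sum.mono_neutral_cong_left) (auto simp: mons_def)
  then show ?thesis
    unfolding poly_funs_def by (auto intro: exI[of _ "\<lambda>m. if m \<in> mons V D then c m else 0"])
qed

text \<open>Coefficients are shifted along the injective map \<open>add_mset v\<close>; a monomial
  of \<open>mons V (Suc D)\<close> outside its image does not contain \<open>v\<close> and receives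
  coefficient 0.\<close>

lemma poly_funs_var_mult:
  assumes "g \<in> poly_funs V D" "v \<in> V" "finite V"
  shows "(\<lambda>y. y v * g y) \<in> poly_funs V (Suc D)"
proof -
  from assms obtain c where c: "\<And>y. g y = (\<Sum>m\<in>mons V D. c m * eval_mon y m)"
    unfolding poly_funs_def by blast
  let ?c = "\<lambda>m. if v \<in># m then c (m - {#v#}) else 0"
  have "y v * g y = (\<Sum>m\<in>mons V (Suc D). ?c m * eval_mon y m)" for y
  proof -
    have inj: "inj_on (add_mset v) (mons V D)" by (auto intro: inj_onI)
    have "y v * g y = (\<Sum>m\<in>mons V D. ?c (add_mset v m) * eval_mon y (add_mset v m))"
      unfolding c sum_distrib_left by (intro sum.cong) (auto simp: eval_mon_def mult_ac)
    also have "\<dots> = (\<Sum>m\<in>add_mset v ` mons V D. ?c m * eval_mon y m)"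
      using inj by (simp add: sum.reindex)
    also have "\<dots> = (\<Sum>m\<in>mons V (Suc D). ?c m * eval_mon y m)"
    proof (intro sum.mono_neutral_left ballI)
      show "finite (mons V (Suc D))" by (rule finite_mons) fact
      show "add_mset v ` mons V D \<subseteq> mons V (Suc D)"
        using assms by (auto simp: mons_def)
      fix m assume m: "m \<in> mons V (Suc D) - add_mset v ` mons V D"
      have "v \<notin># m"
      proof
        assume "v \<in># m"
        then obtain m' where m': "m = add_mset v m'" by (metis multi_member_split)
        with m have "m' \<in> mons V D" by (auto simp: mons_def)
        with m m' show False by auto
      qed
      then show "?c m * eval_mon y m = 0" by simp
    qed
    finally show ?thesis .
  qed
  then show ?thesis
    unfolding poly_funs_def by (auto intro: exI[of _ ?c])
qed

text \<open>Each factor of \<open>m\<close> becomes one multiplication by a linear form, which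
  raises the degree bound by one. Hence a linear change of variables preserves degree
  bounds.\<close>

lemma poly_funs_eval_mon_linear:
  assumes "finite V"
  shows "(\<lambda>y. eval_mon (\<lambda>v. \<Sum>u\<in>V. l v u * y u) m) \<in> poly_funs V (size m)"
proof (induction m)
  case empty
  have "mons V 0 = {{#}}" by (auto simp: mons_def)
  then show ?case
    unfolding poly_funs_def by (auto intro!: exI[of _ "\<lambda>_. 1"] simp: eval_mon_def)
next
  case (add v m)
  let ?e = "\<lambda>y. eval_mon (\<lambda>v. \<Sum>u\<in>V. l v u * y u) m"
  have "(\<lambda>y. \<Sum>u\<in>V. l v u * (y u * ?e y)) \<in> poly_funs V (Suc (size m))"
    using add assms by (intro poly_funs_sum poly_funs_cmult poly_funs_var_mult)
  then show ?case
    by (simp add: eval_mon_def sum_distrib_right mult.assoc)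
qed

lemma poly_funs_eval_mpoly_linear:
  assumes "finite V" "mpoly_degree p \<le> D"
  shows "(\<lambda>y. eval_mpoly (\<lambda>v. \<Sum>u\<in>V. l v u * y u) p) \<in> poly_funs V D"
  unfolding eval_mpoly_def
proof (intro poly_funs_sum poly_funs_cmult)
  fix m assume "m \<in> Poly_Mapping.keys p"
  then have "size m \<le> mpoly_degree p"
    unfolding mpoly_degree_def by (intro Max_ge) auto
  then show "(\<lambda>y. eval_mon (\<lambda>v. \<Sum>u\<in>V. l v u * y u) m) \<in> poly_funs V D"
    using assms by (intro poly_funs_mono[OF poly_funs_eval_mon_linear]) auto
qed

lemma eval_mon_cong: "(\<And>v. v \<in># m \<Longrightarrow> y v = z v) \<Longrightarrow> eval_mon y m = eval_mon z m"
  unfolding eval_mon_def by (simp cong: image_mset_cong)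

lemma eval_mon_eq_0: "v \<in># m \<Longrightarrow> y v = 0 \<Longrightarrow> eval_mon y m = (0::'f::comm_semiring_1)"
  unfolding eval_mon_def by (induction m) auto


section \<open>The part of a polynomial with given indices\<close>

definition index_part ::
    "((nat \<times> 'd) monomial \<Rightarrow> 'f::comm_semiring_1) \<Rightarrow> nat \<Rightarrow> nat \<Rightarrow> nat set \<Rightarrow> (nat \<times> 'd \<Rightarrow> 'f) \<Rightarrow> 'f"
  where "index_part c D N T y =
    (\<Sum>m | m \<in> mons ({1..N} \<times> UNIV) D \<and> fst ` set_mset m = T. c m * eval_mon y m)"

definition restrict_index :: "nat set \<Rightarrow> (nat \<times> 'd \<Rightarrow> 'f::zero) \<Rightarrow> nat \<times> 'd \<Rightarrow> 'f" where
  "restrict_index S y = (\<lambda>(j, a). if j \<in> S then y (j, a) else 0)"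

lemma eval_mon_restrict_index:
  "eval_mon (restrict_index S y) m =
    (if fst ` set_mset m \<subseteq> S then eval_mon y m else (0::'f::comm_semiring_1))"
proof (cases "fst ` set_mset m \<subseteq> S")
  case True
  then show ?thesis by (auto intro!: eval_mon_cong simp: restrict_index_def)
next
  case False
  then obtain j a where "(j, a) \<in># m" "j \<notin> S" by force
  then have "eval_mon (restrict_index S y) m = 0"
    by (intro eval_mon_eq_0[of "(j, a)"]) (auto simp: restrict_index_def)
  with False show ?thesis by simp
qed

text \<open>A monomial survives restriction to \<open>S\<close> exactly when its indices lie in
  \<open>S\<close>; the survivors are grouped by their exact index set.\<close>

lemma sum_index_part:
  fixes y :: "nat \<times> 'd::finite \<Rightarrow> 'f::comm_semiring_1"
  assumes "S \<subseteq> {1..N}"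
  shows "(\<Sum>T\<in>Pow S. index_part c D N T y) =
    (\<Sum>m\<in>mons ({1..N} \<times> UNIV) D. c m * eval_mon (restrict_index S y) m)"
proof -
  let ?M = "mons ({1..N} \<times> (UNIV :: 'd set)) D"
  let ?A = "{m \<in> ?M. fst ` set_mset m \<subseteq> S}"
  have fin: "finite ?M" by (rule finite_mons) simp
  have finS: "finite S" using assms finite_subset by blast
  have "(\<Sum>m\<in>?M. c m * eval_mon (restrict_index S y) m) = (\<Sum>m\<in>?A. c m * eval_mon y m)"
    using fin by (intro sum.mono_neutral_cong_right) (auto simp: eval_mon_restrict_index)
  also have "\<dots> = (\<Sum>T\<in>Pow S. \<Sum>m | m \<in> ?A \<and> fst ` set_mset m = T. c m * eval_mon y m)"
    using fin finS by (intro sum.group[symmetric]) auto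
  also have "\<dots> = (\<Sum>T\<in>Pow S. index_part c D N T y)"
    unfolding index_part_def by (intro sum.cong refl) auto
  finally show ?thesis by simp
qed

text \<open>Moebius inversion in the form of uniqueness: by induction the values at proper subsets
  of \<open>A\<close> agree, and they cancel from the two sums over \<open>Pow A\<close>.\<close>

lemma Pow_sums_determine:
  fixes f g :: "'a set \<Rightarrow> 'b::cancel_comm_monoid_add"
  assumes "finite A" and "\<And>S. S \<subseteq> A \<Longrightarrow> sum f (Pow S) = sum g (Pow S)"
  shows "f A = g A"
  using assms
proof (induction A rule: finite_psubset_induct)
  case (psubset A)
  have "sum f (Pow A - {A}) = sum g (Pow A - {A})"
  proof (rule sum.cong[OF refl])
    fix B assume "B \<in> Pow A - {A}"
    then have "B \<subset> A" by auto
    with psubset show "f B = g B" by (meson order_trans psubset_imp_subset)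
  qed
  moreover have "sum f (Pow A) = f A + sum f (Pow A - {A})"
    "sum g (Pow A) = g A + sum g (Pow A - {A})"
    using psubset.hyps by (auto intro!: sum.remove)
  ultimately show ?case using psubset.prems[of A] by simp
qed


section \<open>Words and monomials\<close>

lemma word_mon_simps [simp]:
  "word_mon [] js = {#}" "word_mon us [] = {#}"
  "word_mon (u # us) (j # js) = Y_mon j u + word_mon us js"
  by (simp_all add: word_mon_def)

lemma filter_Y_mon: "filter_mset (\<lambda>v. fst v = j) (Y_mon i u) = (if i = j then Y_mon i u else {#})"
  by (auto simp: Y_mon_def filter_mset_image_mset)

lemma image_snd_Y_mon: "image_mset snd (Y_mon j u) = u"
  by (simp add: Y_mon_def multiset.map_comp comp_def)

lemma set_word_mon_subset: "fst ` set_mset (word_mon us js) \<subseteq> set js"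
proof (induction js arbitrary: us)
  case (Cons j js)
  then show ?case by (cases us) (auto simp: Y_mon_def)
qed simp

lemma filter_word_mon_absent: "j \<notin> set js \<Longrightarrow> filter_mset (\<lambda>v. fst v = j) (word_mon us js) = {#}"
  using set_word_mon_subset[of us js] by (force simp: filter_mset_eq_conv)

text \<open>Distinct indices keep the factors apart: filtering by the head index isolates its
  factor, and \<open>snd\<close> recovers the letter.\<close>

lemma word_mon_inj:
  assumes "length js = length us" "length us = length vs" "distinct js"
    and "word_mon us js = word_mon vs js"
  shows "us = vs"
  using assms
proof (induction js us vs rule: list_induct3)
  case (Cons j js u us v vs)
  have "filter_mset (\<lambda>w. fst w = j) (word_mon (u # us) (j # js)) =
      filter_mset (\<lambda>w. fst w = j) (word_mon (v # vs) (j # js))"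
    using Cons.prems by simp
  then have "Y_mon j u = Y_mon j v"
    using Cons.prems by (simp add: filter_Y_mon filter_word_mon_absent)
  moreover from this have "u = v" using image_snd_Y_mon by metis
  ultimately show ?case using Cons by simp
qed simp

text \<open>The word is found by splitting \<open>m\<close> by index and forgetting the index in
  each piece; a piece is nonempty because its index occurs in \<open>m\<close>.\<close>

lemma word_mon_surj:
  assumes "distinct js" "fst ` set_mset m = set js"
  shows "\<exists>us. length us = length js \<and> (\<forall>u\<in>set us. u \<noteq> {#}) \<and> word_mon us js = m"
  using assms
proof (induction js arbitrary: m)
  case Nil
  then show ?case by simp
next
  case (Cons j js)
  let ?m = "filter_mset (\<lambda>v. fst v = j) m" and ?m' = "filter_mset (\<lambda>v. fst v \<noteq> j) m"
  let ?u = "image_mset snd ?m"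
  have "fst ` set_mset ?m' = set js"
    using Cons.prems by force
  then obtain us where us: "length us = length js" "\<forall>u\<in>set us. u \<noteq> {#}" "word_mon us js = ?m'"
    using Cons.IH[of ?m'] Cons.prems(1) by auto
  have "Y_mon j ?u = image_mset (\<lambda>v. v) ?m"
    unfolding Y_mon_def multiset.map_comp by (intro image_mset_cong) auto
  then have "word_mon (?u # us) (j # js) = m"
    using us by (simp add: multiset_partition[symmetric])
  moreover have "?u \<noteq> {#}"
    using Cons.prems by (force simp: filter_mset_eq_conv)
  ultimately show ?case
    using us by (intro exI[of _ "?u # us"]) auto
qed

lemma eval_mon_word_mon:
  assumes "length js = length us"
  shows "eval_mon y (word_mon us js) = (\<Prod>(j, u)\<leftarrow>zip js us. eval_mon (\<lambda>a. y (j, a)) u)"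
  using assms
  by (induction js us rule: list_induct2)
    (auto simp: eval_mon_def Y_mon_def multiset.map_comp comp_def)

section \<open>Words of bounded total size\<close>

definition words :: "nat \<Rightarrow> 'd multiset list set" where
  "words D = {us. (\<forall>u\<in>set us. u \<noteq> {#}) \<and> sum_list (map size us) \<le> D}"

lemma finite_words: "finite (words D :: 'd::finite multiset list set)"
proof (rule finite_subset)
  \<comment> \<open>Nonempty letters have size at least 1, so the bound on total size also bounds
    the length.\<close>
  have len: "length us \<le> sum_list (map size us)" if "\<forall>u\<in>set us. u \<noteq> {#}"
    for us :: "'d multiset list"
    using that by (induction us) (auto simp: Suc_le_eq nonempty_has_size intro: add_le_mono)
  have "size u \<le> sum_list (map size us)" if "u \<in> set us" for u and us :: "'d multiset list"
    using that by (intro member_le_sum_list) auto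
  with len show "words D \<subseteq> {us. set us \<subseteq> mons (UNIV :: 'd set) D \<and> length us \<le> D}"
    by (fastforce simp: words_def mons_def)
  show "finite {us. set us \<subseteq> mons (UNIV :: 'd set) D \<and> length us \<le> D}"
    by (intro finite_lists_length_le finite_mons) simp
qed

text \<open>Writing the letters of a word at the indices 1 to \<open>k\<close> is a bijection from
  words of length \<open>k\<close> to monomials that use all of these indices. This turns
  coefficients of monomials into coefficients of words.\<close>

lemma index_part_full:
  fixes z :: "nat \<times> 'd::finite \<Rightarrow> 'f::comm_semiring_1"
  shows "index_part c D k {1..k} z =
    (\<Sum>us | us \<in> words D \<and> length us = k.
      c (word_mon us [1..<Suc k]) * eval_mon z (word_mon us [1..<Suc k]))"
  unfolding index_part_def
proof (rule sum.reindex_bij_betw[symmetric], rule bij_betw_imageI)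
  let ?W = "{us :: 'd multiset list. us \<in> words D \<and> length us = k}"
  let ?M = "{m. m \<in> mons ({1..k} \<times> (UNIV :: 'd set)) D \<and> fst ` set_mset m = {1..k}}"
  let ?w = "\<lambda>us :: 'd multiset list. word_mon us [1..<Suc k]"
  have set: "set [1..<Suc k] = {1..k}" by auto
  show "inj_on ?w ?W"
    by (rule inj_onI, rule word_mon_inj) auto
  show "?w ` ?W = ?M"
  proof (intro equalityI subsetI)
    fix m assume "m \<in> ?w ` ?W"
    then obtain us where us: "us \<in> words D" "length us = k" "m = ?w us" by auto
    have len: "length [1..<Suc k] = length us" using us by simp
    have "fst ` set_mset m = {1..k}"
      using word_mon_indices[OF len] us set by (auto simp: words_def)
    moreover have "size m \<le> D"
      using size_word_mon[OF len] us by (auto simp: words_def)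
    ultimately show "m \<in> ?M" by (simp add: mem_mons_Times_UNIV)
  next
    fix m assume m: "m \<in> ?M"
    then obtain us where us: "length us = length [1..<Suc k]" "\<forall>u\<in>set us. u \<noteq> {#}" "?w us = m"
      using word_mon_surj[of "[1..<Suc k]" m] distinct_upt unfolding set by blast
    with m have "us \<in> ?W"
      using size_word_mon[OF us(1)[symmetric]] by (auto simp: words_def mem_mons_Times_UNIV)
    with us show "m \<in> ?w ` ?W" by blast
  qed
qed


section \<open>Evaluation of quasisymmetric functions\<close>

lemma index_tuples_conv_subsets:
  "bij_betw sorted_list_of_set {T. T \<subseteq> {1..N} \<and> card T = k} {js \<in> index_tuples k. set js \<subseteq> {1..N}}"
proof (rule bij_betwI[where g = set])
  have fin: "finite T" if "T \<subseteq> {1..N}" for T :: "nat set"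
    using that finite_subset by blast
  show "sorted_list_of_set \<in> {T. T \<subseteq> {1..N} \<and> card T = k} \<rightarrow> {js \<in> index_tuples k. set js \<subseteq> {1..N}}"
    using fin by (fastforce simp: index_tuples_def)
  show "set \<in> {js \<in> index_tuples k. set js \<subseteq> {1..N}} \<rightarrow> {T. T \<subseteq> {1..N} \<and> card T = k}"
    by (auto simp: index_tuples_def strict_sorted_iff distinct_card)
  show "set (sorted_list_of_set T) = T" if "T \<in> {T. T \<subseteq> {1..N} \<and> card T = k}" for T
    using that fin by auto
  show "sorted_list_of_set (set js) = js" if "js \<in> {js \<in> index_tuples k. set js \<subseteq> {1..N}}" for js
    using that by (auto simp: index_tuples_def strict_sorted_iff sorted_list_of_set.idem_if_sorted_distinct)
qed

lemma monomial_qsym_size: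
  assumes "us \<in> words D" "monomial_qsym us m \<noteq> 0"
  shows "size m \<le> D"
proof -
  from assms(2) have "{js \<in> index_tuples (length us). word_mon us js = m} \<noteq> {}"
    by (auto simp: monomial_qsym_def simp del: Collect_empty_eq)
  then obtain js where "js \<in> index_tuples (length us)" "word_mon us js = m" by blast
  then show ?thesis
    using size_word_mon[of js us] assms(1) by (auto simp: index_tuples_def words_def)
qed

text \<open>The coefficient of \<open>m\<close> counts the index tuples that yield \<open>m\<close>,
  so the sum over monomials is a sum over tuples grouped by the monomial they yield.\<close>

lemma sum_monomial_qsym:
  fixes y :: "nat \<times> 'd::finite \<Rightarrow> 'f::comm_semiring_1"
  assumes us: "us \<in> words D"
  shows "(\<Sum>m\<in>mons ({1..N} \<times> UNIV) D. monomial_qsym us m * eval_mon y m) =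
    (\<Sum>js | js \<in> index_tuples (length us) \<and> set js \<subseteq> {1..N}. eval_mon y (word_mon us js))"
proof -
  let ?M = "mons ({1..N} \<times> (UNIV :: 'd set)) D"
  let ?J = "{js \<in> index_tuples (length us). set js \<subseteq> {1..N}}"
  have finJ: "finite ?J"
    by (rule finite_subset[OF _ finite_lists_length_eq[of "{1..N}" "length us"]])
      (auto simp: index_tuples_def)
  have ne: "\<forall>u\<in>set us. u \<noteq> {#}" using us by (auto simp: words_def)
  have ind: "fst ` set_mset (word_mon us js) = set js" if "js \<in> index_tuples (length us)" for js
    using word_mon_indices[OF _ ne] that by (auto simp: index_tuples_def)
  have size: "size (word_mon us js) \<le> D" if "js \<in> index_tuples (length us)" for js
    using size_word_mon[of js us] that us by (auto simp: index_tuples_def words_def)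
  have "(\<Sum>m\<in>?M. monomial_qsym us m * eval_mon y m) =
      (\<Sum>m\<in>?M. \<Sum>js | js \<in> ?J \<and> word_mon us js = m. eval_mon y (word_mon us js))"
  proof (rule sum.cong[OF refl])
    fix m assume m: "m \<in> ?M"
    \<comment> \<open>As all letters are nonempty, every index of a tuple is visible in its
      monomial, so the tuples counted for \<open>m\<close> stay within 1 to
      \<open>N\<close>.\<close>
    have "set js \<subseteq> {1..N}" if "js \<in> index_tuples (length us)" "word_mon us js = m" for js
      using m ind[OF that(1)] that(2) by (simp add: mem_mons_Times_UNIV)
    then have "{js \<in> index_tuples (length us). word_mon us js = m} = {js. js \<in> ?J \<and> word_mon us js = m}"
      by auto
    then show "monomial_qsym us m * eval_mon y m =
        (\<Sum>js | js \<in> ?J \<and> word_mon us js = m. eval_mon y (word_mon us js))"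
      by (simp add: monomial_qsym_def)
  qed
  also have "\<dots> = (\<Sum>js\<in>?J. eval_mon y (word_mon us js))"
  proof (rule sum.group[OF finJ])
    show "finite ?M" by (rule finite_mons) simp
    show "word_mon us ` ?J \<subseteq> ?M"
    proof (rule image_subsetI)
      fix js assume js: "js \<in> ?J"
      then show "word_mon us js \<in> ?M"
        using size ind by (simp add: mem_mons_Times_UNIV)
    qed
  qed
  finally show ?thesis by simp
qed

text \<open>The sum defining \<open>eval_mseries\<close> runs over a subset of the finite set
  \<open>mons ({1..N} \<times> UNIV) D\<close>; the additional monomials have coefficient 0 or
  contain a vanishing variable.\<close>

lemma eval_mseries_words:
  fixes y :: "nat \<times> 'd::finite \<Rightarrow> 'f::comm_semiring_1"
  assumes "{v. y v \<noteq> 0} \<subseteq> {1..N} \<times> UNIV"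
  shows "eval_mseries y (\<lambda>m. \<Sum>us\<in>words D. c us * monomial_qsym us m) =
    (\<Sum>us\<in>words D. c us *
      (\<Sum>js | js \<in> index_tuples (length us) \<and> set js \<subseteq> {1..N}. eval_mon y (word_mon us js)))"
proof -
  let ?M = "mons ({1..N} \<times> (UNIV :: 'd set)) D"
  let ?Q = "\<lambda>m. \<Sum>us\<in>words D. c us * monomial_qsym us m"
  have size: "size m \<le> D" if Q: "?Q m \<noteq> 0" for m :: "(nat \<times> 'd) multiset"
  proof -
    from Q obtain us :: "'d multiset list" where
      us: "us \<in> words D" "c us * monomial_qsym us m \<noteq> 0"
      using sum.not_neutral_contains_not_neutral by blast
    then have "(monomial_qsym us m :: 'f) \<noteq> 0" by auto
    with us(1) show ?thesis by (rule monomial_qsym_size)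
  qed
  have "eval_mseries y ?Q = (\<Sum>m\<in>?M. ?Q m * eval_mon y m)"
    unfolding eval_mseries_def
  proof (rule sum.mono_neutral_left)
    show "finite ?M" by (rule finite_mons) simp
    show "{m. ?Q m \<noteq> 0 \<and> set_mset m \<subseteq> {v. y v \<noteq> 0}} \<subseteq> ?M"
      using assms size by (auto simp: mons_def simp del: mem_Sigma_iff)
    show "\<forall>m\<in>?M - {m. ?Q m \<noteq> 0 \<and> set_mset m \<subseteq> {v. y v \<noteq> 0}}. ?Q m * eval_mon y m = 0"
    proof
      fix m assume "m \<in> ?M - {m. ?Q m \<noteq> 0 \<and> set_mset m \<subseteq> {v. y v \<noteq> 0}}"
      then consider "?Q m = 0" | v where "v \<in># m" "y v = 0" by blast
      then show "?Q m * eval_mon y m = 0"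
        by cases (simp_all only: eval_mon_eq_0 mult_zero_left mult_zero_right)
    qed
  qed
  also have "\<dots> = (\<Sum>us\<in>words D. c us * (\<Sum>m\<in>?M. monomial_qsym us m * eval_mon y m))"
    unfolding sum_distrib_right sum_distrib_left
    by (subst sum.swap) (simp add: mult.assoc)
  also have "\<dots> = (\<Sum>us\<in>words D. c us *
      (\<Sum>js | js \<in> index_tuples (length us) \<and> set js \<subseteq> {1..N}. eval_mon y (word_mon us js)))"
    by (intro sum.cong refl) (simp only: sum_monomial_qsym)
  finally show ?thesis .
qed


section \<open>Functions of the list of increments\<close>

text \<open>The sequence that starts at 0 and has the entries of \<open>ys\<close> as successive
  increments; since \<open>take\<close> saturates, it is constant from time \<open>length ys\<close>
  on.\<close>

definition path :: "'a::monoid_add list \<Rightarrow> nat \<Rightarrow> 'a" where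
  "path ys j = sum_list (take j ys)"

lemma path_ev_const: "path ys \<in> ev_const"
  unfolding ev_const_def eventually_sequentially path_def
  by (auto intro!: exI[of _ "sum_list ys"] exI[of _ "length ys"])

lemma time_warp_path: "time_warp (length ys) (path (ys @ zs)) = path (ys @ 0 # zs)"
proof
  fix j
  show "time_warp (length ys) (path (ys @ zs)) j = path (ys @ 0 # zs) j"
  proof (cases "j \<le> length ys")
    case False
    then obtain i where "j = Suc (length ys + i)" by (metis less_iff_Suc_add not_le)
    then show ?thesis by (simp add: time_warp_def path_def)
  qed (simp add: time_warp_def path_def)
qed

text \<open>A zero increment is the trace of a time warp, so it can be deleted. The prefix
  \<open>xs\<close> collects the increments already passed and is generalised in the
  induction.\<close>

lemma warp_invariant_path_filter:
  assumes "warp_invariant F"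
  shows "F (path (xs @ filter (\<lambda>y. y \<noteq> 0) ys)) = F (path (xs @ ys))"
proof (induction ys arbitrary: xs)
  case (Cons y ys)
  show ?case
  proof (cases "y = 0")
    case True
    have "F (path (xs @ 0 # ys)) = F (path (xs @ ys))"
      using assms path_ev_const[of "xs @ ys"]
      unfolding warp_invariant_def time_warp_path[symmetric] by blast
    with True Cons.IH show ?thesis by simp
  next
    case False
    with Cons.IH[of "xs @ [y]"] show ?thesis by simp
  qed
qed simp

section \<open>Sequences as functions of their increments\<close>

definition row :: "(nat \<times> 'd \<Rightarrow> 'f) \<Rightarrow> nat \<Rightarrow> 'f ^ 'd" where
  "row y j = (\<chi> a. y (j, a))"

definition path_of :: "nat \<Rightarrow> (nat \<times> 'd \<Rightarrow> 'f::comm_monoid_add) \<Rightarrow> nat \<Rightarrow> 'f ^ 'd" where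
  "path_of N y = path (map (row y) [1..<Suc N])"

lemma path_of_ev_const: "path_of N y \<in> ev_const"
  unfolding path_of_def by (rule path_ev_const)

lemma row_restrict_index: "row (restrict_index S y) j = (if j \<in> S then row y j else 0)"
  by (simp add: row_def restrict_index_def vec_eq_iff)

lemma path_of_eq_sum: "path_of N y j = (\<Sum>i=1..min j N. row y i)"
proof -
  have "take j [1..<Suc N] = [1..<Suc (min j N)]"
    by (cases "j \<le> N") (simp_all del: upt_Suc)
  then show ?thesis
    unfolding path_of_def path_def take_map
    by (simp add: sum_set_upt_conv_sum_list_nat[symmetric] atLeastLessThanSuc_atLeastAtMost del: upt_Suc)
qed

text \<open>After subtraction of its last value the path vanishes from time \<open>N\<close> on, so
  the polynomial hypothesis applies; the shifted entries are linear forms in the increments, so the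
  uniform bound \<open>D\<close> is kept.\<close>

lemma polynomial_path_of:
  fixes F :: "(nat \<Rightarrow> 'f::comm_ring_1 ^ 'd::finite) \<Rightarrow> 'f"
  assumes "polynomial_seq_fun F" and "translation_invariant F"
  obtains D where "\<And>N. (\<lambda>y. F (path_of N y)) \<in> poly_funs ({1..N} \<times> UNIV) D"
proof -
  from assms(1) obtain D where D: "\<And>N. N \<ge> 1 \<Longrightarrow> \<exists>p :: (nat \<times> 'd, 'f) mpoly.
      mpoly_degree p \<le> D \<and>
      (\<forall>x. F (\<lambda>j. if j \<le> N then x j else 0) = eval_mpoly (\<lambda>(j, a). x j $ a) p)"
    unfolding polynomial_seq_fun_def by blast
  have "(\<lambda>y. F (path_of N y)) \<in> poly_funs ({1..N} \<times> UNIV) D" for N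
  proof -
    let ?V = "{1..N} \<times> (UNIV :: 'd set)"
    \<comment> \<open>The polynomial for \<open>Suc N\<close> is taken because the hypothesis starts
      at 1 and \<open>N\<close> = 0 must be covered.\<close>
    obtain p :: "(nat \<times> 'd, 'f) mpoly" where p: "mpoly_degree p \<le> D"
      "\<And>x. F (\<lambda>j. if j \<le> Suc N then x j else 0) = eval_mpoly (\<lambda>(j, a). x j $ a) p"
      using D[of "Suc N"] by auto
    \<comment> \<open>The value at time \<open>j\<close> minus the last value is minus the sum of
      the increments after time \<open>j\<close>.\<close>
    define l :: "nat \<times> 'd \<Rightarrow> nat \<times> 'd \<Rightarrow> 'f"
      where "l = (\<lambda>(j, a) (i, b). if b = a \<and> j < i then - 1 else 0)"
    have "F (path_of N y) = eval_mpoly (\<lambda>v. \<Sum>u\<in>?V. l v u * y u) p" for y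
    proof -
      let ?t = "path_of N y N"
      have "F (path_of N y) = F (\<lambda>j. path_of N y j + (- ?t))"
        using assms(2) path_of_ev_const[of N y]
        unfolding translation_invariant_def by (blast intro: sym)
      also have "(\<lambda>j. path_of N y j + (- ?t)) =
          (\<lambda>j. if j \<le> Suc N then path_of N y j - ?t else 0)"
        by (auto simp: path_of_eq_sum min_def)
      also have "F \<dots> = eval_mpoly (\<lambda>(j, a). (path_of N y j - ?t) $ a) p"
        by (rule p(2))
      also have "(\<lambda>(j, a). (path_of N y j - ?t) $ a) = (\<lambda>v. \<Sum>u\<in>?V. l v u * y u)"
      proof (rule ext, clarify)
        fix j a
        have "(\<Sum>u\<in>?V. l (j, a) u * y u) =
            (\<Sum>i=1..N. \<Sum>b\<in>UNIV. l (j, a) (i, b) * y (i, b))"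
          by (simp add: sum.cartesian_product)
        also have "\<dots> = (\<Sum>i=1..N. if j < i then - y (i, a) else 0)"
        proof (rule sum.cong[OF refl])
          fix i
          have "(\<Sum>b\<in>UNIV. l (j, a) (i, b) * y (i, b)) =
              (\<Sum>b\<in>UNIV. if b = a then (if j < i then - y (i, a) else 0) else 0)"
            by (rule sum.cong) (auto simp: l_def)
          then show "(\<Sum>b\<in>UNIV. l (j, a) (i, b) * y (i, b)) = (if j < i then - y (i, a) else 0)"
            by simp
        qed
        also have "\<dots> = (\<Sum>i=1..N. (if i \<le> j then y (i, a) else 0) - y (i, a))"
          by (rule sum.cong) auto
        also have "\<dots> = (\<Sum>i=1..min j N. y (i, a)) - (\<Sum>i=1..N. y (i, a))"
        proof -
          have "(\<Sum>i=1..N. if i \<le> j then y (i, a) else 0) = (\<Sum>i=1..min j N. y (i, a))"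
            by (rule sum.mono_neutral_cong_right) auto
          then show ?thesis by (simp add: sum_subtractf)
        qed
        also have "\<dots> = (path_of N y j - ?t) $ a"
          by (simp add: path_of_eq_sum row_def)
        finally show "(path_of N y j - ?t) $ a = (\<Sum>u\<in>?V. l (j, a) u * y u)" by simp
      qed
      finally show ?thesis .
    qed
    then show ?thesis
      using poly_funs_eval_mpoly_linear[of ?V p D l] p(1) by simp
  qed
  then show ?thesis by (rule that)
qed

section \<open>Reduction of each part to a full part\<close>

text \<open>Relabels the indices listed in \<open>js\<close> as 1, 2, and so on; the shift
  reconciles list positions from 0 with increments from 1.\<close>

definition pick :: "nat list \<Rightarrow> (nat \<times> 'd \<Rightarrow> 'f) \<Rightarrow> nat \<times> 'd \<Rightarrow> 'f" where
  "pick js y = (\<lambda>(i, a). y (js ! (i - 1), a))"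

text \<open>Both paths have the same nonzero increments in the same order, namely those of
  \<open>y\<close> at the indices in \<open>S\<close>; only zero increments are placed
  differently.\<close>

lemma warp_invariant_pick:
  assumes F: "warp_invariant F"
    and js: "js \<in> index_tuples k" "set js \<subseteq> {1..N}" "S \<subseteq> set js"
  shows "F (path_of N (restrict_index S y)) =
    F (path_of k (restrict_index {i \<in> {1..k}. js ! (i - 1) \<in> S} (pick js y)))"
proof -
  let ?h = "row (restrict_index S y)"
  have len: "length js = k" using js by (simp add: index_tuples_def)
  have restrict: "map (row (restrict_index {i \<in> {1..k}. js ! (i - 1) \<in> S} (pick js y))) [1..<Suc k] = map ?h js"
    using len
    by (intro nth_equalityI) (auto simp: row_restrict_index simp del: upt_Suc, auto simp: row_def pick_def)
  have js_filter: "filter (\<lambda>j. j \<in> set js) [1..<Suc N] = js"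
  proof (rule sorted_distinct_set_unique)
    show "set (filter (\<lambda>j. j \<in> set js) [1..<Suc N]) = set js"
      using js(2) by auto
  qed (use js in \<open>auto simp: index_tuples_def strict_sorted_iff sorted_wrt_filter simp del: upt_Suc\<close>)
  have "filter (\<lambda>v. v \<noteq> 0) (map ?h (filter (\<lambda>j. j \<in> set js) xs)) =
      filter (\<lambda>v. v \<noteq> 0) (map ?h xs)" for xs
    using js(3) by (induction xs) (auto simp: row_restrict_index)
  from this[of "[1..<Suc N]"]
  have "filter (\<lambda>v. v \<noteq> 0) (map ?h js) = filter (\<lambda>v. v \<noteq> 0) (map ?h [1..<Suc N])"
    unfolding js_filter .
  then show ?thesis
    using warp_invariant_path_filter[OF F, of "[]" "map ?h js"]
      warp_invariant_path_filter[OF F, of "[]" "map ?h [1..<Suc N]"]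
    unfolding path_of_def restrict by simp
qed

text \<open>Both sides are extended to functions of a subset \<open>T\<close> of
  \<open>set js\<close>. Their sums over \<open>Pow S\<close> are values of \<open>F\<close> at
  corresponding restrictions, which agree by warp invariance, so \<open>Pow_sums_determine\<close>
  applies.\<close>

lemma index_part_pick:
  fixes F :: "(nat \<Rightarrow> 'f::comm_ring_1 ^ 'd::finite) \<Rightarrow> 'f"
  assumes F: "warp_invariant F"
    and c: "\<And>N y. F (path_of N y) = (\<Sum>m\<in>mons ({1..N} \<times> UNIV) D. c N m * eval_mon y m)"
    and js: "js \<in> index_tuples k" "set js \<subseteq> {1..N}"
  shows "index_part (c N) D N (set js) y = index_part (c k) D k {1..k} (pick js y)"
proof -
  let ?R = "\<lambda>T. {i \<in> {1..k}. js ! (i - 1) \<in> T}"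
  let ?f = "\<lambda>T. index_part (c N) D N T y"
  let ?g = "\<lambda>T. index_part (c k) D k (?R T) (pick js y)"
  have len: "length js = k" and dist: "distinct js"
    using js by (auto simp: index_tuples_def strict_sorted_iff)
  have img: "(\<lambda>i. js ! (i - 1)) ` {1..k} = set js"
  proof -
    have "(\<lambda>i. js ! (i - 1)) ` Suc ` {..<k} = (!) js ` {..<k}"
      by (simp only: image_image diff_Suc_1)
    also have "\<dots> = set js"
      unfolding set_conv_nth len by blast
    finally show ?thesis by (simp only: image_Suc_lessThan)
  qed
  have "?f (set js) = ?g (set js)"
  proof (rule Pow_sums_determine[where f = ?f and g = ?g])
    fix S assume S: "S \<subseteq> set js"
    \<comment> \<open>Passing from indices to their positions in \<open>js\<close> matches the
      subsets of \<open>S\<close> with those of its position set.\<close>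
    have "bij_betw ?R (Pow S) (Pow (?R S))"
    proof (rule bij_betwI[where g = "\<lambda>R. (\<lambda>i. js ! (i - 1)) ` R"])
      show "(\<lambda>i. js ! (i - 1)) ` ?R T = T" if "T \<in> Pow S" for T
      proof -
        have "T \<subseteq> (\<lambda>i. js ! (i - 1)) ` {1..k}" using that S img by simp
        then show ?thesis by blast
      qed
      show "?R ((\<lambda>i. js ! (i - 1)) ` R) = R" if "R \<in> Pow (?R S)" for R
      proof -
        have "inj_on (\<lambda>i. js ! (i - 1)) {1..k}"
          using dist len by (auto simp: inj_on_def nth_eq_iff_index_eq)
        then show ?thesis using that by (blast dest: inj_onD)
      qed
    qed auto
    then have "sum ?g (Pow S) = (\<Sum>R\<in>Pow (?R S). index_part (c k) D k R (pick js y))"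
      by (rule sum.reindex_bij_betw)
    also have "\<dots> = F (path_of k (restrict_index (?R S) (pick js y)))"
      unfolding c by (rule sum_index_part) auto
    also have "\<dots> = F (path_of N (restrict_index S y))"
      by (rule warp_invariant_pick[OF F js S, symmetric])
    also have "\<dots> = sum ?f (Pow S)"
      unfolding c using S js by (intro sum_index_part[symmetric]) auto
    finally show "sum ?f (Pow S) = sum ?g (Pow S)" by simp
  qed simp
  moreover have "?R (set js) = {1..k}" using img by auto
  ultimately show ?thesis by simp
qed

lemma eval_mon_pick:
  assumes "length js = k" "length us = k"
  shows "eval_mon (pick js y) (word_mon us [1..<Suc k]) = eval_mon y (word_mon us js)"
proof -
  have "map (\<lambda>(j, u). eval_mon (\<lambda>a. pick js y (j, a)) u) (zip [1..<Suc k] us) =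
      map (\<lambda>(j, u). eval_mon (\<lambda>a. y (j, a)) u) (zip js us)"
    using assms by (intro nth_equalityI) (auto simp: pick_def simp del: upt_Suc)
  then show ?thesis using assms by (simp add: eval_mon_word_mon del: upt_Suc)
qed

section \<open>Assembly of the quasisymmetric function\<close>

lemma ev_const_path_of:
  fixes x :: "nat \<Rightarrow> 'f::comm_ring_1 ^ 'd"
  assumes "x \<in> ev_const"
  obtains N where "{v. increments x v \<noteq> 0} \<subseteq> {1..N} \<times> UNIV"
    and "x = (\<lambda>j. path_of N (increments x) j + x 0)"
proof -
  from assms obtain c N where N: "\<And>j. j \<ge> N \<Longrightarrow> x j = c"
    unfolding ev_const_def eventually_sequentially by blast
  \<comment> \<open>At \<open>j = 0\<close> truncated subtraction makes this trivial; beyond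
    \<open>N\<close> both times lie in the constant range.\<close>
  have "x (j - 1) = x j" if "j \<notin> {1..N}" for j
  proof (cases "j = 0")
    case False
    with that show ?thesis using N[of j] N[of "j - 1"] by auto
  qed simp
  then have "{v. increments x v \<noteq> 0} \<subseteq> {1..N} \<times> UNIV"
    by (fastforce simp: increments_def)
  moreover have "x = (\<lambda>j. path_of N (increments x) j + x 0)"
  proof
    fix j
    have tele: "(\<Sum>i=1..n. x i - x (i - 1)) = x n - x 0" for n
      by (induction n) auto
    have "row (increments x) = (\<lambda>i. x i - x (i - 1))"
      by (auto simp: row_def increments_def vec_eq_iff)
    then have "path_of N (increments x) j = x (min j N) - x 0"
      by (simp only: path_of_eq_sum tele)
    moreover have "x (min j N) = x j" using N by (simp add: min_def)
    ultimately show "x j = path_of N (increments x) j + x 0" by simp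
  qed
  ultimately show ?thesis by (rule that)
qed

theorem lemma4p3:
  fixes F :: "(nat \<Rightarrow> 'f::field_char_0 ^ 'd::finite) \<Rightarrow> 'f"
  assumes "polynomial_seq_fun F"
    and "warp_invariant F"
    and "translation_invariant F"
  shows "\<exists>Q :: (nat \<times> 'd, 'f) mseries. Q \<in> qsym \<and>
    (\<forall>x\<in>ev_const. F x = eval_mseries (increments x) Q)"
proof -
  obtain D where "\<And>N. (\<lambda>y. F (path_of N y)) \<in> poly_funs ({1..N} \<times> UNIV) D"
    using polynomial_path_of[OF assms(1,3)] by blast
  then have "\<forall>N. \<exists>c. \<forall>y. F (path_of N y) = (\<Sum>m\<in>mons ({1..N} \<times> UNIV) D. c m * eval_mon y m)"
    unfolding poly_funs_def by blast
  then obtain c where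
    c: "\<And>N y. F (path_of N y) = (\<Sum>m\<in>mons ({1..N} \<times> UNIV) D. c N m * eval_mon y m)"
    by metis
  \<comment> \<open>The coefficient of a word of length k is read off from the polynomial in k
    increments, at the monomial with its letters at indices 1 to k. It does not depend on
    \<open>N\<close>.\<close>
  define C :: "'d multiset list \<Rightarrow> 'f"
    where "C us = c (length us) (word_mon us [1..<Suc (length us)])" for us
  define Q :: "(nat \<times> 'd, 'f) mseries" where "Q = (\<lambda>m. \<Sum>us\<in>words D. C us * monomial_qsym us m)"
  have "Q \<in> qsym"
    unfolding qsym_def Q_def using finite_words[of D, where 'd = 'd] by (auto simp: words_def)
  moreover have "F x = eval_mseries (increments x) Q" if x: "x \<in> ev_const" for x
  proof -
    obtain N where N: "{v. increments x v \<noteq> 0} \<subseteq> {1..N} \<times> UNIV"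
        "x = (\<lambda>j. path_of N (increments x) j + x 0)"
      using ev_const_path_of[OF x] .
    define y where "y = increments x"
    have y: "restrict_index {1..N} y = y"
    proof
      fix v
      show "restrict_index {1..N} y v = y v"
        using N(1) by (cases v) (auto simp: restrict_index_def y_def)
    qed
    let ?E = "\<lambda>T us. C us * eval_mon y (word_mon us (sorted_list_of_set T))"
    have pick: "eval_mon (pick (sorted_list_of_set T) y) (word_mon us [1..<Suc (card T)]) =
        eval_mon y (word_mon us (sorted_list_of_set T))"
      if "length us = card T" for T and us :: "'d multiset list"
      using that by (intro eval_mon_pick) simp_all
    \<comment> \<open>The part at \<open>T\<close> equals a full part in \<open>card T\<close>
      picked increments, and its expansion over words has the coefficients \<open>C\<close>.\<close>
    have part: "index_part (c N) D N T y = (\<Sum>us | us \<in> words D \<and> length us = card T. ?E T us)"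
      if T: "T \<in> Pow {1..N}" for T
    proof -
      let ?js = "sorted_list_of_set T"
      have js: "?js \<in> index_tuples (card T)" "set ?js \<subseteq> {1..N}"
        using bij_betwE[OF index_tuples_conv_subsets[of N "card T"]] T by auto
      have "set ?js = T" using T finite_subset by fastforce
      then have "index_part (c N) D N T y = index_part (c (card T)) D (card T) {1..card T} (pick ?js y)"
        using index_part_pick[OF assms(2) c js] by metis
      also have "\<dots> = (\<Sum>us | us \<in> words D \<and> length us = card T. ?E T us)"
        unfolding index_part_full
        by (intro sum.cong refl) (auto simp: C_def pick[unfolded One_nat_def] simp del: upt_Suc)
      finally show ?thesis .
    qed
    have "F x = F (path_of N y)"
      using assms(3) path_of_ev_const[of N y] unfolding translation_invariant_def
      by (subst N(2)) (simp add: y_def)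
    also have "\<dots> = (\<Sum>T\<in>Pow {1..N}. index_part (c N) D N T y)"
      by (simp only: c sum_index_part[OF subset_refl] y)
    also have "\<dots> = (\<Sum>T\<in>Pow {1..N}. \<Sum>us | us \<in> words D \<and> length us = card T. ?E T us)"
      by (rule sum.cong[OF refl part])
    \<comment> \<open>Exchanging the sums leaves, for each word, the index sets of its length;
      listed increasingly, these are the index tuples of its monomial quasisymmetric
      function.\<close>
    also have "\<dots> = (\<Sum>us\<in>words D. \<Sum>T | T \<in> Pow {1..N} \<and> length us = card T. ?E T us)"
      by (rule sum.swap_restrict) (simp_all add: finite_words)
    also have "\<dots> = (\<Sum>us\<in>words D. C us *
      (\<Sum>js | js \<in> index_tuples (length us) \<and> set js \<subseteq> {1..N}. eval_mon y (word_mon us js)))"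
    proof (rule sum.cong[OF refl])
      fix us :: "'d multiset list"
      have "(\<Sum>T | T \<in> Pow {1..N} \<and> length us = card T. ?E T us) =
          (\<Sum>T | T \<subseteq> {1..N} \<and> card T = length us. ?E T us)"
        by (rule sum.cong) auto
      also have "\<dots> = (\<Sum>js | js \<in> index_tuples (length us) \<and> set js \<subseteq> {1..N}.
          C us * eval_mon y (word_mon us js))"
        by (rule sum.reindex_bij_betw[OF index_tuples_conv_subsets])
      finally show "(\<Sum>T | T \<in> Pow {1..N} \<and> length us = card T. ?E T us) = C us *
          (\<Sum>js | js \<in> index_tuples (length us) \<and> set js \<subseteq> {1..N}. eval_mon y (word_mon us js))"
        by (simp add: sum_distrib_left)
    qed
    also have "\<dots> = eval_mseries y Q"
      unfolding Q_def using N(1) by (intro eval_mseries_words[symmetric]) (simp add: y_def)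
    finally show ?thesis by (simp add: y_def)
  qed
  ultimately show ?thesis by blast
qed

end
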